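(* Let $V_1,V_2,W\subset X$ be subspaces and let $P$ be the orthogonal projection of $X$ onto $W$. If $V_1\perp V_2$, then $$\cos \Theta_{V_1\oplus V_2,W} = \cos \Theta_{V_1,W}\cdot \cos \Theta_{V_2,W}\cdot \cos \Theta^\perp_{P(V_1),P(V_2)}.$$
   Context: $X$ is an $n$-dimensional vector space over $\mathbb{R}$ (real case) or $\mathbb{C}$ (complex case) with inner product $\langle\cdot,\cdot\rangle$ (Hermitian in the complex case, conjugate-linear in the first argument). Blades: a $p$-blade is a simple multivector $\nu=v_1\wedge\cdots\wedge v_p\in\Lambda^pX$; if $\nu\neq0$ it represents the $p$-dimensional subspace $V=\mathrm{span}(v_1,\ldots,v_p)$. Nonzero scalars in $\Lambda^0X$ are $0$-blades representing $\{0\}$. $\Lambda X$ has the inner product given on $p$-blades by $\langle v_1\wedge\cdots\wedge v_p,\,w_1\wedge\cdots\wedge w_p\rangle=\det(\langle v_i,w_j\rangle)$, extended (sesqui)linearly, with distinct grades orthogonal; $\|\nu\|=\sqrt{\langle\nu,\nu\rangle}$. Grassmann angle: for subspaces $V,W\subset X$, let $P_W$ be the orthogonal projection of $X$ onto $W$, acting on blades by $P_W(v_1\wedge\cdots\wedge v_p)=P_Wv_1\wedge\cdots\wedge P_Wv_p$ (identity on scalars). The Grassmann angle $\Theta_{V,W}\in[0,\frac\pi2]$ is defined by $\cos\Theta_{V,W}=\|P_W\nu\|/\|\nu\|$ for any nonzero blade $\nu$ representing $V$ (independent of $\nu$); in particular $\Theta_{\{0\},W}=0$. The complementary Grassmann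 angle is $\Theta^\perp_{V,W}=\Theta_{V,W^\perp}$, where $W^\perp$ is the orthogonal complement of $W$ in $X$. *)

theory Defs
  imports Complex_Main "Jordan_Normal_Form.Determinant" "Jordan_Normal_Form.Conjugate"
begin

text \<open>The scalar field: a common class for the real numbers (trivial conjugation) and the complex
  numbers (complex conjugation), so that one development covers both cases. The axioms
  force \<open>conjugate x\<close> to be the usual conjugate and \<open>re_part x\<close> the usual real part.\<close>

class rc_scalar = conjugatable_field + real_normed_field +
  fixes re_part :: "'a \<Rightarrow> real"
  assumes mult_conjugate: "x * conjugate x = (norm x)\<^sup>2 *\<^sub>R 1"
    and add_conjugate: "x + conjugate x = (2 * re_part x) *\<^sub>R 1"

instantiation real :: rc_scalar
begin
definition re_part_real :: "real \<Rightarrow> real" where "re_part_real x = x"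
instance by standard (auto simp: re_part_real_def power2_eq_square)
end

instantiation complex :: rc_scalar
begin
definition re_part_complex :: "complex \<Rightarrow> real" where "re_part_complex z = Re z"
instance
proof
  fix z :: complex
  show "z * conjugate z = (norm z)\<^sup>2 *\<^sub>R 1"
    unfolding conjugate_complex_def complex_mult_cnj
    by (simp add: cmod_power2 scaleR_conv_of_real)
  show "z + conjugate z = (2 * re_part z) *\<^sub>R 1"
    unfolding conjugate_complex_def re_part_complex_def complex_add_cnj
    by (simp add: scaleR_conv_of_real)
qed
end

text \<open>The space \<open>X\<close> is the whole type \<open>'v\<close>; the set \<open>Basis\<close> of the library locale only serves to
  express finite dimension and enters none of the definitions below.\<close>

locale fin_inner_space = finite_dimensional_vector_space scale Basis
  for scale :: "'k::rc_scalar \<Rightarrow> 'v::ab_group_add \<Rightarrow> 'v" (infixr \<open>*s\<close> 75) and Basis :: "'v set" +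
  fixes ip :: "'v \<Rightarrow> 'v \<Rightarrow> 'k"
  assumes ip_add_right: "ip x (y + z) = ip x y + ip x z"
    and ip_scale_right: "ip x (c *s y) = c * ip x y"
    and ip_commute: "ip y x = conjugate (ip x y)"
    and ip_positive: "x \<noteq> 0 \<Longrightarrow> re_part (ip x x) > 0"
begin

definition orth :: "'v set \<Rightarrow> 'v set \<Rightarrow> bool" where
  "orth V W \<longleftrightarrow> (\<forall>v\<in>V. \<forall>w\<in>W. ip v w = 0)"

definition orth_comp :: "'v set \<Rightarrow> 'v set" where
  "orth_comp W = {x. \<forall>w\<in>W. ip w x = 0}"

definition orth_proj :: "'v set \<Rightarrow> 'v \<Rightarrow> 'v" where
  "orth_proj W x = (THE y. y \<in> W \<and> x - y \<in> orth_comp W)"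

text \<open>The exterior algebra, realised inside the dual of the space of alternating forms: an
  alternating form takes a list of any length \<open>p\<close> as argument (so it is a family with one
  alternating \<open>p\<close>-linear form for each \<open>p\<close>), and \<open>v\<^sub>1 \<and> \<dots> \<and> v\<^sub>p\<close> is evaluation at
  \<open>[v\<^sub>1, \<dots>, v\<^sub>p]\<close>. Hence two multivectors are equal iff all alternating forms agree on them.
  In particular \<open>wedge []\<close> is the unit scalar of the exterior power of degree 0.\<close>

definition alternating :: "('v list \<Rightarrow> 'k) \<Rightarrow> bool" where
  "alternating \<phi> \<longleftrightarrow>
     (\<forall>us x y ws. \<phi> (us @ (x + y) # ws) = \<phi> (us @ x # ws) + \<phi> (us @ y # ws)) \<and>
     (\<forall>us c x ws. \<phi> (us @ (c *s x) # ws) = c * \<phi> (us @ x # ws)) \<and>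
     (\<forall>us. \<not> distinct us \<longrightarrow> \<phi> us = 0)"

definition wedge :: "'v list \<Rightarrow> ('v list \<Rightarrow> 'k) \<Rightarrow> 'k" where
  "wedge vs = (\<lambda>\<phi>. if alternating \<phi> then \<phi> vs else 0)"

inductive_set multivectors :: "(('v list \<Rightarrow> 'k) \<Rightarrow> 'k) set" where
  wedge: "wedge vs \<in> multivectors"
| add: "\<mu> \<in> multivectors \<Longrightarrow> \<nu> \<in> multivectors \<Longrightarrow> (\<lambda>\<phi>. \<mu> \<phi> + \<nu> \<phi>) \<in> multivectors"
| scale: "\<nu> \<in> multivectors \<Longrightarrow> (\<lambda>\<phi>. c * \<nu> \<phi>) \<in> multivectors"

definition gram_det :: "'v list \<Rightarrow> 'v list \<Rightarrow> 'k" where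
  "gram_det vs ws =
     (if length vs = length ws
      then det (mat (length vs) (length vs) (\<lambda>(i, j). ip (vs ! i) (ws ! j))) else 0)"

text \<open>The inner product of multivectors is the sesquilinear extension of \<open>gram_det\<close>. In closed form:
  \<open>\<nu> (gram_det vs)\<close> is the inner product of \<open>wedge vs\<close> with \<open>\<nu>\<close>; its conjugate is an alternating
  form in \<open>vs\<close>, at which \<open>\<mu>\<close> is evaluated. See \<open>ext_inner_wedge\<close> below, and
  \<open>ext_inner_add_left\<close>, \<open>ext_inner_scale_left\<close>, \<open>ext_inner_add_right\<close> and
  \<open>ext_inner_scale_right\<close>.\<close>

definition ext_inner :: "(('v list \<Rightarrow> 'k) \<Rightarrow> 'k) \<Rightarrow> (('v list \<Rightarrow> 'k) \<Rightarrow> 'k) \<Rightarrow> 'k" where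
  "ext_inner \<mu> \<nu> = conjugate (\<mu> (\<lambda>vs. conjugate (\<nu> (gram_det vs))))"

definition ext_norm :: "(('v list \<Rightarrow> 'k) \<Rightarrow> 'k) \<Rightarrow> real" where
  "ext_norm \<nu> = sqrt (re_part (ext_inner \<nu> \<nu>))"

text \<open>The action of a linear map on multivectors, see \<open>ext_map_wedge\<close>.\<close>

definition ext_map :: "('v \<Rightarrow> 'v) \<Rightarrow> (('v list \<Rightarrow> 'k) \<Rightarrow> 'k) \<Rightarrow> ('v list \<Rightarrow> 'k) \<Rightarrow> 'k" where
  "ext_map f \<nu> = (\<lambda>\<phi>. if alternating \<phi> then \<nu> (\<lambda>vs. \<phi> (map f vs)) else 0)"

text \<open>The scalar \<open>c\<close> matters only for \<open>0\<close>-blades; otherwise it can be absorbed into a vector.\<close>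

definition represents :: "(('v list \<Rightarrow> 'k) \<Rightarrow> 'k) \<Rightarrow> 'v set \<Rightarrow> bool" where
  "represents \<nu> V \<longleftrightarrow>
     \<nu> \<noteq> (\<lambda>\<phi>. 0) \<and> (\<exists>c vs. \<nu> = (\<lambda>\<phi>. c * wedge vs \<phi>) \<and> V = span (set vs))"

definition grassmann_angle :: "'v set \<Rightarrow> 'v set \<Rightarrow> real" where
  "grassmann_angle V W =
     (THE \<theta>. 0 \<le> \<theta> \<and> \<theta> \<le> pi / 2 \<and>
        (\<forall>\<nu>. represents \<nu> V \<longrightarrow> cos \<theta> = ext_norm (ext_map (orth_proj W) \<nu>) / ext_norm \<nu>))"

definition comp_grassmann_angle :: "'v set \<Rightarrow> 'v set \<Rightarrow> real" where
  "comp_grassmann_angle V W = grassmann_angle V (orth_comp W)"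

lemma conjugate_one: "conjugate (1::'k) = 1"
proof -
  have "conjugate (1::'k) * conjugate 1 = conjugate 1 * 1"
    by (metis conjugate_dist_mul mult.right_neutral)
  then show ?thesis
    by (metis conjugate_zero_iff mult_left_cancel zero_neq_one)
qed

lemma comm_ring_hom_conjugate: "comm_ring_hom (conjugate :: 'k \<Rightarrow> 'k)"
  by unfold_locales (auto simp: conjugate_dist_add conjugate_dist_mul conjugate_one)

lemma gram_det_commute: "gram_det ws vs = conjugate (gram_det vs ws)"
proof (cases "length vs = length ws")
  case True
  let ?n = "length ws"
  interpret conj: comm_ring_hom "conjugate :: 'k \<Rightarrow> 'k" by (rule comm_ring_hom_conjugate)
  let ?A = "mat ?n ?n (\<lambda>(i, j). ip (vs ! i) (ws ! j))"
  have "mat ?n ?n (\<lambda>(i, j). ip (ws ! i) (vs ! j)) = map_mat conjugate (transpose_mat ?A)"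
    by (rule eq_matI) (auto simp: ip_commute[symmetric])
  moreover have "det (transpose_mat ?A) = det ?A"
    by (rule det_transpose[of _ ?n]) auto
  ultimately show ?thesis
    using True by (simp add: gram_det_def)
next
  case False
  then show ?thesis by (auto simp: gram_det_def)
qed

lemma gram_det_expand:
  assumes "length vs = length us + Suc (length ws)"
  shows "\<exists>(S :: (nat \<Rightarrow> nat) set) R. \<forall>x. gram_det vs (us @ x # ws) = (\<Sum>p\<in>S. R p * ip (vs ! p (length us)) x)"
proof -
  let ?n = "length vs" and ?k = "length us"
  let ?S = "{p. p permutes {0..<?n}}"
  let ?R = "\<lambda>p. signof p * (\<Prod>j\<in>{0..<?n} - {?k}. ip (vs ! p j) ((us @ 0 # ws) ! j))"
  have "gram_det vs (us @ x # ws) = (\<Sum>p\<in>?S. ?R p * ip (vs ! p ?k) x)" for x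
  proof -
    let ?A = "mat ?n ?n (\<lambda>(i, j). ip (vs ! i) ((us @ x # ws) ! j))"
    have "gram_det vs (us @ x # ws) = det ?A"
      using assms by (simp add: gram_det_def)
    also have "\<dots> = (\<Sum>p\<in>?S. signof p * (\<Prod>j<?n. ?A $$ (p j, j)))"
      by (rule det_col) auto
    also have "\<dots> = (\<Sum>p\<in>?S. ?R p * ip (vs ! p ?k) x)"
    proof (rule sum.cong[OF refl])
      fix p assume "p \<in> ?S"
      then have p: "p permutes {0..<?n}" by simp
      have k: "?k \<in> {0..<?n}" using assms by simp
      have "(\<Prod>j<?n. ?A $$ (p j, j)) = (\<Prod>j\<in>{0..<?n}. ip (vs ! p j) ((us @ x # ws) ! j))"
        using permutes_in_image[OF p] by (intro prod.cong) (auto simp: lessThan_atLeast0)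
      also have "\<dots> = ip (vs ! p ?k) x *
          (\<Prod>j\<in>{0..<?n} - {?k}. ip (vs ! p j) ((us @ x # ws) ! j))"
        using prod.remove[OF _ k, of "\<lambda>j. ip (vs ! p j) ((us @ x # ws) ! j)"] by simp
      also have "(\<Prod>j\<in>{0..<?n} - {?k}. ip (vs ! p j) ((us @ x # ws) ! j)) =
          (\<Prod>j\<in>{0..<?n} - {?k}. ip (vs ! p j) ((us @ 0 # ws) ! j))"
        by (intro prod.cong) (auto simp: nth_append nth_Cons split: nat.splits)
      finally show "signof p * (\<Prod>j<?n. ?A $$ (p j, j)) = ?R p * ip (vs ! p ?k) x"
        by simp
    qed
    finally show ?thesis .
  qed
  then show ?thesis by (intro exI[of _ ?S] exI[of _ ?R]) blast
qed

lemma alternating_gram_det: "alternating (gram_det vs)"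
  unfolding alternating_def
proof (intro conjI allI impI)
  fix us x y ws
  show "gram_det vs (us @ (x + y) # ws) = gram_det vs (us @ x # ws) + gram_det vs (us @ y # ws)"
  proof (cases "length vs = length us + Suc (length ws)")
    case True
    from gram_det_expand[OF this] obtain S :: "(nat \<Rightarrow> nat) set" and R
      where "\<And>x. gram_det vs (us @ x # ws) = (\<Sum>p\<in>S. R p * ip (vs ! p (length us)) x)" by blast
    then show ?thesis by (simp add: ip_add_right distrib_left sum.distrib)
  qed (simp add: gram_det_def)
next
  fix us c x ws
  show "gram_det vs (us @ (c *s x) # ws) = c * gram_det vs (us @ x # ws)"
  proof (cases "length vs = length us + Suc (length ws)")
    case True
    from gram_det_expand[OF this] obtain S :: "(nat \<Rightarrow> nat) set" and R
      where "\<And>x. gram_det vs (us @ x # ws) = (\<Sum>p\<in>S. R p * ip (vs ! p (length us)) x)" by blast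
    then show ?thesis by (simp add: ip_scale_right sum_distrib_left mult_ac)
  qed (simp add: gram_det_def)
next
  fix us :: "'v list" assume "\<not> distinct us"
  then obtain i j where ij: "i < length us" "j < length us" "i \<noteq> j" "us ! i = us ! j"
    by (auto simp: distinct_conv_nth)
  show "gram_det vs us = 0"
  proof (cases "length vs = length us")
    case True
    have "det (mat (length us) (length us) (\<lambda>(i, j). ip (vs ! i) (us ! j))) = 0"
      by (rule det_identical_columns[of _ "length us" i j]) (use ij in auto)
    then show ?thesis using True by (simp add: gram_det_def)
  qed (simp add: gram_det_def)
qed

lemma conjugate_wedge_gram_det: "(\<lambda>vs. conjugate (wedge ws (gram_det vs))) = gram_det ws"
  unfolding wedge_def by (simp add: alternating_gram_det gram_det_commute[symmetric])

lemma ext_inner_wedge: "ext_inner (wedge vs) (wedge ws) = gram_det vs ws"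
  unfolding ext_inner_def conjugate_wedge_gram_det
  unfolding wedge_def by (simp add: alternating_gram_det gram_det_commute[symmetric])

lemma ext_inner_add_left: "ext_inner (\<lambda>\<phi>. \<mu> \<phi> + \<mu>' \<phi>) \<nu> = ext_inner \<mu> \<nu> + ext_inner \<mu>' \<nu>"
  by (simp add: ext_inner_def conjugate_dist_add)

lemma ext_inner_scale_left: "ext_inner (\<lambda>\<phi>. c * \<mu> \<phi>) \<nu> = conjugate c * ext_inner \<mu> \<nu>"
  by (simp add: ext_inner_def conjugate_dist_mul)

lemma multivector_alternating:
  assumes "\<mu> \<in> multivectors" "alternating \<phi>" "alternating \<psi>"
  shows "\<mu> (\<lambda>vs. \<phi> vs + \<psi> vs) = \<mu> \<phi> + \<mu> \<psi>" "\<mu> (\<lambda>vs. c * \<phi> vs) = c * \<mu> \<phi>"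
proof -
  have "alternating (\<lambda>vs. \<phi> vs + \<psi> vs)" "alternating (\<lambda>vs. c * \<phi> vs)"
    using assms(2,3) by (auto simp: alternating_def algebra_simps)
  note alt = this assms(2,3)
  have "\<mu> (\<lambda>vs. \<phi> vs + \<psi> vs) = \<mu> \<phi> + \<mu> \<psi> \<and> \<mu> (\<lambda>vs. c * \<phi> vs) = c * \<mu> \<phi>"
    using assms(1)
    by (induction rule: multivectors.induct) (simp_all add: alt wedge_def algebra_simps)
  then show "\<mu> (\<lambda>vs. \<phi> vs + \<psi> vs) = \<mu> \<phi> + \<mu> \<psi>" "\<mu> (\<lambda>vs. c * \<phi> vs) = c * \<mu> \<phi>"
    by auto
qed

lemma alternating_conjugate_gram_det:
  assumes "\<nu> \<in> multivectors"
  shows "alternating (\<lambda>vs. conjugate (\<nu> (gram_det vs)))"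
  using assms
proof (induction rule: multivectors.induct)
  case (wedge ws)
  then show ?case by (simp add: conjugate_wedge_gram_det alternating_gram_det)
qed (auto simp: alternating_def conjugate_dist_add conjugate_dist_mul algebra_simps)

lemma ext_inner_add_right:
  assumes "\<mu> \<in> multivectors" "\<nu> \<in> multivectors" "\<nu>' \<in> multivectors"
  shows "ext_inner \<mu> (\<lambda>\<phi>. \<nu> \<phi> + \<nu>' \<phi>) = ext_inner \<mu> \<nu> + ext_inner \<mu> \<nu>'"
  unfolding ext_inner_def conjugate_dist_add
    multivector_alternating(1)[OF assms(1) assms(2,3)[THEN alternating_conjugate_gram_det]]
  by (rule refl)

lemma ext_inner_scale_right:
  assumes "\<mu> \<in> multivectors" "\<nu> \<in> multivectors"
  shows "ext_inner \<mu> (\<lambda>\<phi>. c * \<nu> \<phi>) = c * ext_inner \<mu> \<nu>"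
  using multivector_alternating(2)[OF assms(1) assms(2,2)[THEN alternating_conjugate_gram_det],
      of "conjugate c"]
  by (simp add: ext_inner_def conjugate_dist_mul)

lemma ext_map_wedge:
  assumes "Vector_Spaces.linear scale scale f"
  shows "ext_map f (wedge vs) = wedge (map f vs)"
proof
  fix \<phi>
  interpret f: Vector_Spaces.linear scale scale f by (rule assms)
  have "alternating (\<lambda>vs. \<phi> (map f vs))" if "alternating \<phi>"
    using that by (auto simp: alternating_def f.add f.scale distinct_map)
  then show "ext_map f (wedge vs) \<phi> = wedge (map f vs) \<phi>"
    by (auto simp: ext_map_def wedge_def)
qed

lemma ext_map_add: "ext_map f (\<lambda>\<phi>. \<mu> \<phi> + \<nu> \<phi>) = (\<lambda>\<phi>. ext_map f \<mu> \<phi> + ext_map f \<nu> \<phi>)"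
  by (auto simp: ext_map_def)

lemma ext_map_scale: "ext_map f (\<lambda>\<phi>. c * \<nu> \<phi>) = (\<lambda>\<phi>. c * ext_map f \<nu> \<phi>)"
  by (auto simp: ext_map_def)

end

end

theory Submission
  imports Defs
begin

text \<open>Write \<open>g\<close> for the Gram determinant of a list of vectors. If \<open>vs\<close> is a basis of \<open>V\<close>, the squared
  cosine of the Grassmann angle is \<open>g (P vs) / g vs\<close>. Orthogonalising the vectors \<open>us\<close> against
  the span \<open>U\<close> of \<open>ws\<close> gives \<open>g (ws @ us) = g ws * g (Q us)\<close>, with \<open>Q\<close> the projection onto the
  complement of \<open>U\<close>. Applied to bases of \<open>V\<^sub>2\<close> and \<open>V\<^sub>1\<close> this splits the denominator (\<open>Q\<close> is
  the identity on \<open>V\<^sub>1\<close>), and applied to their images under \<open>P\<close> it splits the numerator, the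
  factor \<open>g (Q (P us)) / g (P us)\<close> being the squared cosine of the complementary angle. If
  \<open>g (P us) = 0\<close>, both sides vanish.\<close>

context fin_inner_space
begin

subsection \<open>Inner product and orthogonal projection\<close>

text \<open>By \<open>mult_conjugate\<close> the product of a real scalar with its conjugate is its
  square; a nonzero factor cancels.\<close>

lemma conjugate_of_real: "conjugate (of_real r :: 'k) = of_real r"
proof (cases "r = 0")
  case False
  have "of_real r * conjugate (of_real r :: 'k) = of_real r * of_real r"
    using mult_conjugate[of "of_real r :: 'k"] by (simp add: scaleR_conv_of_real power2_eq_square)
  then show ?thesis using False by simp
qed simp

lemma re_part_of_real: "re_part (of_real r :: 'k) = r"
proof -
  have "(of_real (2 * re_part (of_real r :: 'k)) :: 'k) = of_real (2 * r)"
    using add_conjugate[of "of_real r :: 'k"]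
    by (simp only: conjugate_of_real scaleR_conv_of_real) simp
  then show ?thesis by (simp only: of_real_eq_iff)
qed

text \<open>Lets conjugation-invariant scalars such as \<open>ip x x\<close> and
  \<open>gram_det vs vs\<close> pass to the reals, where they can be compared by order.\<close>

lemma of_real_re_part:
  assumes "conjugate z = (z :: 'k)"
  shows "of_real (re_part z) = z"
proof -
  have "z + z = of_real (2 * re_part z)"
    using add_conjugate[of z] assms by (simp add: scaleR_conv_of_real)
  then have "2 * z = 2 * of_real (re_part z)" by (simp only: mult_2) simp
  then show ?thesis by simp
qed

lemma ip_add_left: "ip (x + y) z = ip x z + ip y z"
  by (metis ip_commute ip_add_right conjugate_dist_add)

lemma ip_zero_right [simp]: "ip x 0 = 0"
  using ip_add_right[of x 0 0] by simp

lemma ip_zero_left [simp]: "ip 0 x = 0"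
  using ip_commute[of 0 x] by (metis ip_commute ip_zero_right conjugate_zero)

lemma ip_eq_0_commute: "ip x y = 0 \<longleftrightarrow> ip y x = 0"
  by (metis ip_commute conjugate_zero)

lemma ip_minus_right: "ip x (- y) = - ip x y"
  using ip_add_right[of x y "- y"] by (simp add: eq_neg_iff_add_eq_0 add.commute)

lemma ip_diff_right: "ip x (y - z) = ip x y - ip x z"
  using ip_add_right[of x y "- z"] by (simp add: ip_minus_right)

lemma ip_sum_right: "ip x (\<Sum>i\<in>I. f i) = (\<Sum>i\<in>I. ip x (f i))"
  by (induction I rule: infinite_finite_induct) (simp_all add: ip_add_right)

definition sqnorm :: "'v \<Rightarrow> real" where
  "sqnorm x = re_part (ip x x)"

lemma of_real_sqnorm: "of_real (sqnorm x) = ip x x"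
  unfolding sqnorm_def by (rule of_real_re_part) (rule ip_commute[symmetric])

lemma sqnorm_zero [simp]: "sqnorm 0 = 0"
  using re_part_of_real[of 0] by (simp add: sqnorm_def)

lemma sqnorm_pos: "x \<noteq> 0 \<Longrightarrow> sqnorm x > 0"
  unfolding sqnorm_def by (rule ip_positive)

lemma sqnorm_nonneg: "sqnorm x \<ge> 0"
  by (cases "x = 0") (auto dest: sqnorm_pos)

lemma ip_self_eq_0_iff: "ip x x = 0 \<longleftrightarrow> x = 0"
  using sqnorm_pos[of x] of_real_sqnorm[of x] by (metis ip_zero_left less_irrefl of_real_eq_0_iff)

lemma sqnorm_add_orth:
  assumes "ip x y = 0"
  shows "sqnorm (x + y) = sqnorm x + sqnorm y"
proof -
  have "(of_real (sqnorm (x + y)) :: 'k) = of_real (sqnorm x + sqnorm y)"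
    using assms ip_eq_0_commute[of x y]
    by (simp add: of_real_sqnorm ip_add_left ip_add_right)
  then show ?thesis by (simp only: of_real_eq_iff)
qed

section \<open>Orthogonal complements and decompositions\<close>

lemma subspace_orth_comp: "subspace (orth_comp W)"
  by (auto simp: subspace_def orth_comp_def ip_add_right ip_scale_right)

lemma orth_comp_span: "x \<in> orth_comp (span S)" if "\<And>s. s \<in> S \<Longrightarrow> ip s x = 0"
proof -
  have "span S \<subseteq> orth_comp {x}"
    using that by (intro span_minimal subspace_orth_comp) (auto simp: orth_comp_def ip_eq_0_commute[of x])
  then show ?thesis by (auto simp: orth_comp_def ip_eq_0_commute[of _ x])
qed

text \<open>The difference \<open>y - z\<close> lies both in \<open>W\<close> and in its complement,
  so it is orthogonal to itself.\<close>

lemma orth_decomp_unique: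
  assumes "subspace W" "y \<in> W" "x - y \<in> orth_comp W" "z \<in> W" "x - z \<in> orth_comp W"
  shows "y = z"
proof -
  have "y - z \<in> W" using assms by (auto intro: subspace_diff)
  moreover have "y - z \<in> orth_comp W"
    using subspace_diff[OF subspace_orth_comp assms(5,3)] by simp
  ultimately show ?thesis using ip_self_eq_0_iff[of "y - z"] by (auto simp: orth_comp_def)
qed

text \<open>A Gram--Schmidt step: the component of the new spanning vector orthogonal to the previous
  span corrects the projection.\<close>

lemma orth_decomp_span_exists:
  assumes "finite S"
  shows "\<exists>y. y \<in> span S \<and> x - y \<in> orth_comp (span S)"
  using assms
proof (induction S arbitrary: x rule: finite_induct)
  case empty
  then show ?case by (auto simp: orth_comp_def)
next
  case (insert w S)
  obtain a where a: "a \<in> span S" "w - a \<in> orth_comp (span S)" using insert.IH by blast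
  obtain y where y: "y \<in> span S" "x - y \<in> orth_comp (span S)" using insert.IH by blast
  let ?b = "w - a"
  \<comment> \<open>The coefficient of \<open>x\<close> along \<open>?b\<close>: it makes
    \<open>x - ?z\<close> orthogonal to \<open>?b\<close>. If \<open>?b = 0\<close>, that
    orthogonality is trivial.\<close>
  let ?c = "ip ?b x / ip ?b ?b"
  let ?z = "y + ?c *s ?b"
  have sub: "span S \<subseteq> span (insert w S)" by (intro span_mono) auto
  have "w \<in> span (insert w S)" by (intro span_base) auto
  then have z: "?z \<in> span (insert w S)"
    using a(1) y(1) sub by (intro span_add span_scale span_diff) auto
  have S: "ip s (x - ?z) = 0" if "s \<in> span S" for s
  proof -
    have "ip s ?b = 0" "ip s (x - y) = 0" using that a(2) y(2) by (auto simp: orth_comp_def)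
    moreover have "x - ?z = (x - y) - ?c *s ?b" by simp
    ultimately show ?thesis by (simp only: ip_diff_right[of s "x - y"] ip_scale_right) simp
  qed
  have "ip ?b y = 0"
    using a(2) y(1) by (auto simp: orth_comp_def ip_eq_0_commute[of _ y])
  then have b: "ip ?b (x - ?z) = 0"
    using ip_self_eq_0_iff[of ?b]
    by (cases "?b = 0") (simp_all only: ip_diff_right[of ?b x] ip_add_right ip_scale_right ip_zero_left, simp_all)
  have "ip w (x - ?z) = 0"
    using b S[OF a(1)] ip_add_left[of ?b a "x - ?z"] by simp
  then have "x - ?z \<in> orth_comp (span (insert w S))"
    using S by (intro orth_comp_span) (auto intro: span_base)
  with z show ?case by blast
qed

lemma obtain_basis_list:
  assumes "subspace V"
  obtains vs where "distinct vs" "independent (set vs)" "span (set vs) = V"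
proof -
  obtain B where B: "B \<subseteq> V" "independent B" "V \<subseteq> span B" by (rule maximal_independent_subset)
  obtain vs where "set vs = B" "distinct vs"
    using finite_distinct_list[OF finiteI_independent[OF B(2)]] by blast
  moreover have "span B = V" using B(1,3) span_minimal[OF B(1) assms] by blast
  ultimately show ?thesis using that B(2) by blast
qed

text \<open>Existence over a finite spanning list, together with uniqueness, makes the
  \<open>THE\<close> in \<open>orth_proj\<close> well defined.\<close>

lemma orth_proj_decomp:
  assumes "subspace W"
  shows "orth_proj W x \<in> W" "x - orth_proj W x \<in> orth_comp W"
proof -
  obtain vs where vs: "span (set vs) = W" using obtain_basis_list[OF assms] by metis
  obtain y where "y \<in> W \<and> x - y \<in> orth_comp W"
    using orth_decomp_span_exists[of "set vs" x] vs by auto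
  then have "orth_proj W x \<in> W \<and> x - orth_proj W x \<in> orth_comp W"
    unfolding orth_proj_def by (rule theI) (use \<open>y \<in> W \<and> x - y \<in> orth_comp W\<close> in \<open>auto intro: orth_decomp_unique[OF assms]\<close>)
  then show "orth_proj W x \<in> W" "x - orth_proj W x \<in> orth_comp W" by auto
qed

lemma orth_proj_eqI:
  assumes "subspace W" "y \<in> W" "x - y \<in> orth_comp W"
  shows "orth_proj W x = y"
  using orth_decomp_unique[OF assms(1) orth_proj_decomp[OF assms(1)] assms(2,3)] .

lemma linear_orth_proj:
  assumes W: "subspace W"
  shows "Vector_Spaces.linear scale scale (orth_proj W)"
  unfolding Vector_Spaces.linear_iff
proof (intro conjI allI vector_space_axioms)
  note oc = subspace_orth_comp[of W]
  show "orth_proj W (x + y) = orth_proj W x + orth_proj W y" for x y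
  proof (rule orth_proj_eqI[OF W])
    show "x + y - (orth_proj W x + orth_proj W y) \<in> orth_comp W"
      using subspace_add[OF oc orth_proj_decomp(2)[OF W, of x] orth_proj_decomp(2)[OF W, of y]]
      by (simp add: algebra_simps)
  qed (intro subspace_add W orth_proj_decomp)
  show "orth_proj W (c *s x) = c *s orth_proj W x" for c x
  proof (rule orth_proj_eqI[OF W])
    show "c *s x - c *s orth_proj W x \<in> orth_comp W"
      using subspace_scale[OF oc orth_proj_decomp(2)[OF W, of x], of c]
      by (simp add: scale_right_diff_distrib)
  qed (intro subspace_scale W orth_proj_decomp)
qed

lemma orth_proj_orth_comp:
  assumes "subspace W"
  shows "orth_proj (orth_comp W) x = x - orth_proj W x"
proof (rule orth_proj_eqI[OF subspace_orth_comp orth_proj_decomp(2)[OF assms]])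
  show "x - (x - orth_proj W x) \<in> orth_comp (orth_comp W)"
    using orth_proj_decomp(1)[OF assms, of x]
    by (auto simp: orth_comp_def ip_eq_0_commute[of _ "orth_proj W x"])
qed

lemma sqnorm_orth_proj_le:
  assumes "subspace W"
  shows "sqnorm (orth_proj W x) \<le> sqnorm x"
proof -
  have "sqnorm x = sqnorm (orth_proj W x) + sqnorm (x - orth_proj W x)"
    using orth_proj_decomp[OF assms, of x] sqnorm_add_orth[of "orth_proj W x" "x - orth_proj W x"]
    by (simp add: orth_comp_def)
  then show ?thesis using sqnorm_nonneg[of "x - orth_proj W x"] by simp
qed

text \<open>Subtracting a vector of \<open>W\<close> does not change the component orthogonal to
  \<open>W\<close>, and a projection never lengthens a vector.\<close>

lemma sqnorm_orth_comp_proj_le: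
  assumes "subspace W" "w \<in> W"
  shows "sqnorm (orth_proj (orth_comp W) x) \<le> sqnorm (x - w)"
proof -
  interpret P: Vector_Spaces.linear scale scale "orth_proj W"
    by (rule linear_orth_proj[OF assms(1)])
  have "orth_proj W w = w"
    using assms by (intro orth_proj_eqI) (auto simp: orth_comp_def)
  then have "orth_proj (orth_comp W) (x - w) = orth_proj (orth_comp W) x"
    by (simp add: orth_proj_orth_comp[OF assms(1)] P.diff)
  then show ?thesis
    using sqnorm_orth_proj_le[OF subspace_orth_comp, of W "x - w"] by simp
qed

subsection \<open>Gram determinants\<close>

lemma alternating_add: "alternating \<phi> \<Longrightarrow> \<phi> (us @ (x + y) # ws) = \<phi> (us @ x # ws) + \<phi> (us @ y # ws)"
  and alternating_scale: "alternating \<phi> \<Longrightarrow> \<phi> (us @ (c *s x) # ws) = c * \<phi> (us @ x # ws)"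
  and alternating_not_distinct: "alternating \<phi> \<Longrightarrow> \<not> distinct us \<Longrightarrow> \<phi> us = 0"
  by (auto simp: alternating_def)

text \<open>The entries \<open>x\<close> at which the form vanishes form a subspace, and it contains
  every other entry because a repetition gives 0.\<close>

lemma alternating_span_eq_0:
  assumes "alternating \<phi>" "x \<in> span (set us \<union> set ws)"
  shows "\<phi> (us @ x # ws) = 0"
proof -
  let ?Z = "{x. \<phi> (us @ x # ws) = 0}"
  have "subspace ?Z"
    using alternating_scale[OF assms(1), of us 0 0 ws]
    by (auto simp: subspace_def alternating_add[OF assms(1)] alternating_scale[OF assms(1)])
  moreover have "set us \<union> set ws \<subseteq> ?Z"
    by (auto intro!: alternating_not_distinct[OF assms(1)])
  ultimately show ?thesis using span_minimal[of "set us \<union> set ws" ?Z] assms(2) by auto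
qed

lemma alternating_dependent_eq_0:
  assumes "alternating \<phi>" "\<not> (distinct vs \<and> independent (set vs))"
  shows "\<phi> vs = 0"
proof (cases "distinct vs")
  case True
  then obtain a where a: "a \<in> set vs" "a \<in> span (set vs - {a})"
    using assms(2) by (auto simp: dependent_def)
  obtain us ws where vs: "vs = us @ a # ws" using split_list[OF a(1)] by blast
  have "set vs - {a} = set us \<union> set ws" using True vs by auto
  then show ?thesis using alternating_span_eq_0[OF assms(1)] a(2) vs by simp
qed (simp add: alternating_not_distinct[OF assms(1)])

lemma alternating_append_shift:
  assumes "alternating \<phi>" "\<And>x. x \<in> set ws \<Longrightarrow> f x - x \<in> span (set us)"
  shows "\<phi> (us @ map f ws) = \<phi> (us @ ws)"
  using assms(2)
proof (induction ws arbitrary: us)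
  case (Cons x ws)
  \<comment> \<open>Entries are replaced from left to right: the correction \<open>f x - x\<close>
    contributes 0, and \<open>x\<close> then joins the prefix, whose span only grows.\<close>
  have "f x - x \<in> span (set us \<union> set (map f ws))"
    using Cons.prems[of x] span_mono[of "set us" "set us \<union> set (map f ws)"] by auto
  from alternating_span_eq_0[OF assms(1) this]
  have "\<phi> (us @ map f (x # ws)) = \<phi> ((us @ [x]) @ map f ws)"
    using alternating_add[OF assms(1), of us x "f x - x" "map f ws"] by simp
  also have "\<dots> = \<phi> ((us @ [x]) @ ws)"
    using Cons.prems span_mono[of "set us" "set (us @ [x])"] by (intro Cons.IH) auto
  finally show ?case by simp
qed simp

text \<open>The upper right block of the Gram matrix vanishes, so its determinant is that of a block
  triangular matrix.\<close>

lemma gram_det_append_orth: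
  assumes "\<And>u w. u \<in> set us \<Longrightarrow> w \<in> set ws \<Longrightarrow> ip u w = 0"
  shows "gram_det (us @ ws) (us @ ws) = gram_det us us * gram_det ws ws"
proof -
  let ?m = "length us" and ?n = "length ws"
  let ?A = "mat ?m ?m (\<lambda>(i, j). ip (us ! i) (us ! j))"
  let ?C = "mat ?n ?m (\<lambda>(i, j). ip (ws ! i) (us ! j))"
  let ?D = "mat ?n ?n (\<lambda>(i, j). ip (ws ! i) (ws ! j))"
  have "mat (?m + ?n) (?m + ?n) (\<lambda>(i, j). ip ((us @ ws) ! i) ((us @ ws) ! j))
      = four_block_mat ?A (0\<^sub>m ?m ?n) ?C ?D"
    by (rule eq_matI) (auto simp: nth_append assms)
  moreover have "det (four_block_mat ?A (0\<^sub>m ?m ?n) ?C ?D) = det ?A * det ?D"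
    by (rule det_four_block_mat_upper_right_zero) auto
  ultimately show ?thesis by (simp add: gram_det_def)
qed

text \<open>The squared volume of the parallelepiped spanned by \<open>vs\<close>, that is, the
  squared norm of \<open>wedge vs\<close>.\<close>

definition gram :: "'v list \<Rightarrow> real" where
  "gram vs = re_part (gram_det vs vs)"

lemma of_real_gram: "of_real (gram vs) = gram_det vs vs"
  unfolding gram_def by (rule of_real_re_part) (rule gram_det_commute[symmetric])

lemma gram_append_orth:
  assumes "\<And>u w. u \<in> set us \<Longrightarrow> w \<in> set ws \<Longrightarrow> ip u w = 0"
  shows "gram (us @ ws) = gram us * gram ws"
proof -
  have "(of_real (gram (us @ ws)) :: 'k) = of_real (gram us * gram ws)"
    by (simp add: of_real_gram gram_det_append_orth[OF assms])
  then show ?thesis by (simp only: of_real_eq_iff)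
qed

lemma gram_append:
  "gram (us @ ws) = gram us * gram (map (orth_proj (orth_comp (span (set us)))) ws)"
proof -
  let ?U = "span (set us)" and ?f = "orth_proj (orth_comp (span (set us)))"
  have U: "subspace ?U" by (rule subspace_span)
  have shift: "?f x - x \<in> ?U" for x
    using subspace_neg[OF U orth_proj_decomp(1)[OF U, of x]] by (simp add: orth_proj_orth_comp[OF U])
  \<comment> \<open>This changes the second argument only; conjugate symmetry then changes the
    first.\<close>
  have *: "gram_det a (us @ map ?f ws) = gram_det a (us @ ws)" for a
    by (rule alternating_append_shift[OF alternating_gram_det shift])
  have "gram_det (us @ map ?f ws) (us @ map ?f ws) = gram_det (us @ ws) (us @ ws)"
    using * by (metis gram_det_commute)
  then have "gram (us @ ws) = gram (us @ map ?f ws)" by (simp add: gram_def)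
  also have "\<dots> = gram us * gram (map ?f ws)"
    using orth_proj_decomp(1)[OF subspace_orth_comp[of ?U]]
    by (intro gram_append_orth) (auto simp: orth_comp_def span_base)
  finally show ?thesis .
qed

lemma gram_Nil [simp]: "gram [] = 1"
  using re_part_of_real[of 1] by (simp add: gram_def gram_det_def)

lemma gram_singleton: "gram [x] = sqnorm x"
  by (simp add: gram_def gram_det_def sqnorm_def det_single)

text \<open>Squared volume is squared base times squared height. This drives the inductions for
  sign, positivity and monotonicity under projection.\<close>

lemma gram_snoc: "gram (vs @ [x]) = gram vs * sqnorm (orth_proj (orth_comp (span (set vs))) x)"
  by (simp add: gram_append gram_singleton)

lemma gram_nonneg: "gram vs \<ge> 0"
  by (induction vs rule: rev_induct) (simp_all add: gram_snoc sqnorm_nonneg)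

lemma gram_pos:
  assumes "distinct vs" "independent (set vs)"
  shows "gram vs > 0"
  using assms
proof (induction vs rule: rev_induct)
  case (snoc x vs)
  have x: "x \<notin> span (set vs)" and "independent (set vs)"
    using snoc.prems by (simp_all add: independent_insert)
  then have "gram vs > 0" using snoc by simp
  moreover have "orth_proj (orth_comp (span (set vs))) x \<noteq> 0"
    using x orth_proj_decomp(1)[OF subspace_span, of "set vs" x]
    by (auto simp: orth_proj_orth_comp[OF subspace_span])
  ultimately show ?case by (simp add: gram_snoc sqnorm_pos)
qed simp

lemma gram_eq_0_iff: "gram vs = 0 \<longleftrightarrow> \<not> (distinct vs \<and> independent (set vs))"
proof
  show "gram vs = 0" if "\<not> (distinct vs \<and> independent (set vs))"
    using alternating_dependent_eq_0[OF alternating_gram_det that] of_real_gram[of vs]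
    by (metis of_real_eq_0_iff)
qed (auto dest: gram_pos)

text \<open>Each height factor shrinks. With \<open>?v\<close> the foot of the perpendicular from
  \<open>x\<close>, the height over the projected base is at most the distance from the image of
  \<open>x\<close> to that of \<open>?v\<close>, and projecting shortens
  \<open>x - ?v\<close>.\<close>

lemma gram_map_orth_proj_le:
  assumes W: "subspace W"
  shows "gram (map (orth_proj W) vs) \<le> gram vs"
proof (induction vs rule: rev_induct)
  case (snoc x vs)
  interpret P: Vector_Spaces.linear scale scale "orth_proj W" by (rule linear_orth_proj[OF W])
  let ?V = "span (set vs)" and ?v = "orth_proj (span (set vs)) x"
  have "orth_proj W ?v \<in> span (set (map (orth_proj W) vs))"
    using orth_proj_decomp(1)[OF subspace_span, of "set vs" x] by (simp add: P.span_image)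
  then have "sqnorm (orth_proj (orth_comp (span (set (map (orth_proj W) vs)))) (orth_proj W x))
      \<le> sqnorm (orth_proj W x - orth_proj W ?v)"
    by (rule sqnorm_orth_comp_proj_le[OF subspace_span])
  also have "\<dots> \<le> sqnorm (x - ?v)"
    using sqnorm_orth_proj_le[OF W, of "x - ?v"] by (simp add: P.diff)
  also have "x - ?v = orth_proj (orth_comp ?V) x"
    by (simp add: orth_proj_orth_comp[OF subspace_span])
  finally show ?case
    using snoc.IH by (simp only: map_append list.map gram_snoc) (intro mult_mono gram_nonneg sqnorm_nonneg)
qed simp

text \<open>Both Gram determinants are multiplied by the same factor when the basis is changed, since
  \<open>f\<close> preserves the coefficients of the change of basis.\<close>

lemma gram_map_same_span:
  assumes f: "Vector_Spaces.linear scale scale f"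
    and len: "length vs = length ws" and ws: "distinct ws" and span: "set vs \<subseteq> span (set ws)"
  shows "gram (map f vs) * gram ws = gram (map f ws) * gram vs"
proof -
  interpret f: Vector_Spaces.linear scale scale f by (rule f)
  let ?n = "length ws"
  have "\<exists>u. vs ! j = (\<Sum>i<?n. u i *s ws ! i)" if "j < ?n" for j
  proof -
    have "vs ! j \<in> span (set ws)" using span that len by auto
    then obtain u where "vs ! j = (\<Sum>w\<in>set ws. u w *s w)"
      by (auto simp: span_finite)
    also have "\<dots> = (\<Sum>i<?n. u (ws ! i) *s ws ! i)"
      by (rule sum.reindex_bij_betw[symmetric, OF bij_betw_nth[OF ws refl refl]])
    finally show ?thesis by (intro exI[of _ "\<lambda>i. u (ws ! i)"])
  qed
  then obtain C where C: "vs ! j = (\<Sum>i<?n. C j i *s ws ! i)" if "j < ?n" for j by metis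
  \<comment> \<open>Column \<open>j\<close> of this matrix holds the coordinates of
    \<open>vs ! j\<close> with respect to \<open>ws\<close>.\<close>
  define d where "d = det (mat ?n ?n (\<lambda>(i, j). C j i))"
  \<comment> \<open>Stated for every linear \<open>h\<close>, so that it covers both
    \<open>f\<close> and the identity with the same \<open>d\<close>.\<close>
  have key: "gram_det a (map h vs) = gram_det a (map h ws) * d"
    if h: "Vector_Spaces.linear scale scale h" for a h
  proof (cases "length a = ?n")
    case True
    interpret h: Vector_Spaces.linear scale scale h by (rule h)
    have "mat ?n ?n (\<lambda>(i, j). ip (a ! i) (map h vs ! j)) =
        mat ?n ?n (\<lambda>(i, j). ip (a ! i) (map h ws ! j)) * mat ?n ?n (\<lambda>(i, j). C j i)"
      using len
      by (intro eq_matI)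
        (auto simp: scalar_prod_def C h.sum h.scale ip_sum_right ip_scale_right mult.commute
          lessThan_atLeast0 intro!: sum.cong)
    moreover have "det (mat ?n ?n (\<lambda>(i, j). ip (a ! i) (map h ws ! j)) * mat ?n ?n (\<lambda>(i, j). C j i))
        = det (mat ?n ?n (\<lambda>(i, j). ip (a ! i) (map h ws ! j))) * d"
      unfolding d_def by (rule det_mult) auto
    ultimately show ?thesis using True len by (simp add: gram_det_def)
  qed (simp add: gram_det_def len)
  have sq: "gram_det (map h vs) (map h vs) = gram_det (map h ws) (map h ws) * (conjugate d * d)"
    if h: "Vector_Spaces.linear scale scale h" for h
  proof -
    have "gram_det (map h vs) (map h vs) = conjugate (gram_det (map h ws) (map h vs)) * d"
      using key[OF h, of "map h vs"] gram_det_commute[of "map h vs" "map h ws"] by simp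
    also have "\<dots> = conjugate (gram_det (map h ws) (map h ws)) * (conjugate d * d)"
      by (simp add: key[OF h] conjugate_dist_mul mult_ac)
    finally show ?thesis by (simp add: gram_det_commute[symmetric])
  qed
  \<comment> \<open>Both sides are \<open>gram (map f ws) * gram ws\<close> times
    \<open>conjugate d * d\<close>.\<close>
  have "(of_real (gram (map f vs) * gram ws) :: 'k) = of_real (gram (map f ws) * gram vs)"
    using sq[OF f] sq[OF linear_id] by (simp add: of_real_gram)
  then show ?thesis by (simp only: of_real_eq_iff)
qed

subsection \<open>Grassmann angles as ratios of Gram determinants\<close>

lemma ext_norm_scale_wedge: "ext_norm (\<lambda>\<phi>. c * wedge vs \<phi>) = norm c * sqrt (gram vs)"
proof -
  have "ext_inner (\<lambda>\<phi>. c * wedge vs \<phi>) (\<lambda>\<phi>. c * wedge vs \<phi>) = (c * conjugate c) * gram_det vs vs"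
    by (simp add: ext_inner_scale_left ext_inner_scale_right ext_inner_wedge
        multivectors.wedge multivectors.scale)
  also have "\<dots> = of_real ((norm c)\<^sup>2 * gram vs)"
    by (simp add: mult_conjugate scaleR_conv_of_real of_real_gram)
  finally show ?thesis by (simp only: ext_norm_def re_part_of_real) (simp add: real_sqrt_mult)
qed

text \<open>The alternating form \<open>gram_det vs\<close> detects independence: at
  \<open>vs\<close> it takes a nonzero value when \<open>vs\<close> is distinct and
  independent.\<close>

lemma wedge_eq_0_iff: "wedge vs = (\<lambda>\<phi>. 0) \<longleftrightarrow> \<not> (distinct vs \<and> independent (set vs))"
proof
  assume "wedge vs = (\<lambda>\<phi>. 0)"
  then have "wedge vs (gram_det vs) = 0" by simp
  then have "gram_det vs vs = 0" by (simp add: wedge_def alternating_gram_det)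
  then show "\<not> (distinct vs \<and> independent (set vs))"
    using of_real_gram[of vs] gram_eq_0_iff[of vs] by simp
next
  assume "\<not> (distinct vs \<and> independent (set vs))"
  then show "wedge vs = (\<lambda>\<phi>. 0)"
    using alternating_dependent_eq_0 unfolding wedge_def by metis
qed

text \<open>All blades of the subspace give the same ratio by \<open>gram_map_same_span\<close>. The
  ratio lies in [0, 1], so its \<open>arccos\<close> is the unique admissible angle.\<close>

lemma cos_grassmann_angle:
  assumes W: "subspace W" and vs: "distinct vs" "independent (set vs)"
  shows "cos (grassmann_angle (span (set vs)) W) = sqrt (gram (map (orth_proj W) vs) / gram vs)"
proof -
  let ?P = "orth_proj W" and ?V = "span (set vs)"
  define r where "r = sqrt (gram (map ?P vs) / gram vs)"
  have lin: "Vector_Spaces.linear scale scale ?P" by (rule linear_orth_proj[OF W])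
  have r: "0 \<le> r" "r \<le> 1"
    using gram_pos[OF vs] gram_nonneg[of "map ?P vs"] gram_map_orth_proj_le[OF W, of vs]
    by (simp_all add: r_def)
  have ratio: "ext_norm (ext_map ?P \<nu>) / ext_norm \<nu> = r" if \<nu>: "represents \<nu> ?V" for \<nu>
  proof -
    obtain c ws where cws: "\<nu> = (\<lambda>\<phi>. c * wedge ws \<phi>)" "?V = span (set ws)" "\<nu> \<noteq> (\<lambda>\<phi>. 0)"
      using \<nu> by (auto simp: represents_def)
    then have c: "c \<noteq> 0" and ws: "distinct ws" "independent (set ws)"
      using wedge_eq_0_iff[of ws] by auto
    have "length ws = length vs"
      using cws(2) vs ws by (metis dim_span_eq_card_independent distinct_card)
    then have "gram (map ?P ws) * gram vs = gram (map ?P vs) * gram ws"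
      using cws(2) vs(1) span_superset by (intro gram_map_same_span[OF lin]) auto
    then have "gram (map ?P ws) / gram ws = gram (map ?P vs) / gram vs"
      using gram_pos[OF vs] gram_pos[OF ws] by (simp add: frac_eq_eq)
    then show ?thesis
      using c by (simp add: cws(1) ext_map_scale ext_map_wedge[OF lin] ext_norm_scale_wedge r_def
          flip: real_sqrt_divide)
  qed
  \<comment> \<open>At least one representing blade must exist, or the condition on the angle would
    be vacuous and would not determine it.\<close>
  have rep: "represents (wedge vs) ?V"
    unfolding represents_def using wedge_eq_0_iff[of vs] vs
    by (auto intro!: exI[of _ "1::'k"] exI[of _ vs])
  have "grassmann_angle ?V W = arccos r"
    unfolding grassmann_angle_def
  proof (rule the_equality)
    show "0 \<le> arccos r \<and> arccos r \<le> pi / 2 \<and>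
        (\<forall>\<nu>. represents \<nu> ?V \<longrightarrow> cos (arccos r) = ext_norm (ext_map ?P \<nu>) / ext_norm \<nu>)"
      using r ratio arccos_le_pi2[OF r] by (auto simp: arccos_lbound)
  next
    fix \<theta> assume "0 \<le> \<theta> \<and> \<theta> \<le> pi / 2 \<and>
        (\<forall>\<nu>. represents \<nu> ?V \<longrightarrow> cos \<theta> = ext_norm (ext_map ?P \<nu>) / ext_norm \<nu>)"
    then have "0 \<le> \<theta>" "\<theta> \<le> pi" "cos \<theta> = r" using rep ratio pi_gt_zero by (auto simp del: pi_gt_zero)
    then show "\<theta> = arccos r" using arccos_cos[of \<theta>] by simp
  qed
  then show ?thesis using r by (simp add: cos_arccos flip: r_def)
qed

section \<open>The angle of an orthogonal sum\<close>

lemma cos_grassmann_angle_orth_sum: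
  assumes V\<^sub>1: "subspace V\<^sub>1" and V\<^sub>2: "subspace V\<^sub>2" and W: "subspace W" and orth: "orth V\<^sub>1 V\<^sub>2"
  shows "cos (grassmann_angle {v\<^sub>1 + v\<^sub>2 | v\<^sub>1 v\<^sub>2. v\<^sub>1 \<in> V\<^sub>1 \<and> v\<^sub>2 \<in> V\<^sub>2} W) =
      cos (grassmann_angle V\<^sub>1 W) * cos (grassmann_angle V\<^sub>2 W) *
      cos (comp_grassmann_angle (orth_proj W ` V\<^sub>1) (orth_proj W ` V\<^sub>2))"
proof -
  let ?P = "orth_proj W"
  interpret P: Vector_Spaces.linear scale scale ?P by (rule linear_orth_proj[OF W])
  obtain us where us: "distinct us" "independent (set us)" "span (set us) = V\<^sub>1"
    by (rule obtain_basis_list[OF V\<^sub>1])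
  obtain ws where ws: "distinct ws" "independent (set ws)" "span (set ws) = V\<^sub>2"
    by (rule obtain_basis_list[OF V\<^sub>2])
  let ?Q = "orth_proj (orth_comp (?P ` V\<^sub>2))"
  have sum: "{v\<^sub>1 + v\<^sub>2 | v\<^sub>1 v\<^sub>2. v\<^sub>1 \<in> V\<^sub>1 \<and> v\<^sub>2 \<in> V\<^sub>2} = span (set (ws @ us))"
    using span_Un[of "set us" "set ws"] us(3) ws(3) by (simp add: Un_commute)
  have gram_sum: "gram (ws @ us) = gram ws * gram us"
  proof (rule gram_append_orth)
    fix w u assume "w \<in> set ws" "u \<in> set us"
    then have "ip u w = 0"
      using orth us(3) ws(3) by (auto simp: orth_def intro: span_base)
    then show "ip w u = 0" by (simp only: ip_eq_0_commute[of w u])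
  qed
  \<comment> \<open>A nonzero Gram determinant yields the independence of the joined bases.\<close>
  then have "gram (ws @ us) \<noteq> 0"
    using gram_pos us(1,2) ws(1,2) by fastforce
  then have ind: "distinct (ws @ us)" "independent (set (ws @ us))"
    using gram_eq_0_iff by blast+
  have gram_proj: "gram (map ?P (ws @ us)) = gram (map ?P ws) * gram (map ?Q (map ?P us))"
    by (simp only: map_append gram_append) (simp add: P.span_image ws(3))
  have lhs: "cos (grassmann_angle {v\<^sub>1 + v\<^sub>2 | v\<^sub>1 v\<^sub>2. v\<^sub>1 \<in> V\<^sub>1 \<and> v\<^sub>2 \<in> V\<^sub>2} W) =
      sqrt (gram (map ?P ws) * gram (map ?Q (map ?P us)) / (gram ws * gram us))"
    using cos_grassmann_angle[OF W ind] by (simp only: sum gram_sum gram_proj)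
  have c1: "cos (grassmann_angle V\<^sub>1 W) = sqrt (gram (map ?P us) / gram us)"
    using cos_grassmann_angle[OF W us(1,2)] by (simp only: us(3))
  have c2: "cos (grassmann_angle V\<^sub>2 W) = sqrt (gram (map ?P ws) / gram ws)"
    using cos_grassmann_angle[OF W ws(1,2)] by (simp only: ws(3))
  show ?thesis
  proof (cases "gram (map ?P us) = 0")
    case True
    then have "gram (map ?Q (map ?P us)) = 0"
      using gram_map_orth_proj_le[OF subspace_orth_comp, of "?P ` V\<^sub>2" "map ?P us"]
        gram_nonneg[of "map ?Q (map ?P us)"] by simp
    then show ?thesis using True by (simp only: lhs c1) simp
  next
    case False
    then have Pus: "distinct (map ?P us)" "independent (set (map ?P us))"
      using gram_eq_0_iff by blast+
    have "span (set (map ?P us)) = ?P ` V\<^sub>1"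
      by (simp add: P.span_image us(3))
    then have c3: "cos (comp_grassmann_angle (?P ` V\<^sub>1) (?P ` V\<^sub>2)) =
        sqrt (gram (map ?Q (map ?P us)) / gram (map ?P us))"
      using cos_grassmann_angle[OF subspace_orth_comp Pus, of "?P ` V\<^sub>2"]
      by (simp only: comp_grassmann_angle_def)
    show ?thesis
      \<comment> \<open>The factor \<open>gram (map ?P us)\<close> cancels between \<open>c1\<close>
        and \<open>c3\<close>.\<close>
      unfolding lhs c1 c2 c3 using False by (simp flip: real_sqrt_mult)
  qed
qed

end

theorem theorem5p11:
  fixes scale :: "'k::rc_scalar \<Rightarrow> 'v::ab_group_add \<Rightarrow> 'v"
    and Basis :: "'v set"
    and ip :: "'v \<Rightarrow> 'v \<Rightarrow> 'k"
    and V\<^sub>1 V\<^sub>2 W :: "'v set"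
    and P :: "'v \<Rightarrow> 'v"
  assumes "fin_inner_space scale Basis ip"
    and "Modules.module.subspace scale V\<^sub>1"
    and "Modules.module.subspace scale V\<^sub>2"
    and "Modules.module.subspace scale W"
    and "P = fin_inner_space.orth_proj ip W"
    and "fin_inner_space.orth ip V\<^sub>1 V\<^sub>2"
  shows "cos (fin_inner_space.grassmann_angle scale ip {v\<^sub>1 + v\<^sub>2 | v\<^sub>1 v\<^sub>2. v\<^sub>1 \<in> V\<^sub>1 \<and> v\<^sub>2 \<in> V\<^sub>2} W) =
      cos (fin_inner_space.grassmann_angle scale ip V\<^sub>1 W) *
      cos (fin_inner_space.grassmann_angle scale ip V\<^sub>2 W) *
      cos (fin_inner_space.comp_grassmann_angle scale ip (P ` V\<^sub>1) (P ` V\<^sub>2))"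
proof -
  interpret fin_inner_space scale Basis ip by (rule assms(1))
  show ?thesis
    using cos_grassmann_angle_orth_sum[OF assms(2,3,4,6)] by (simp only: assms(5))
qed

end
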